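(* For $l\geq 0$ let $o_l$ be the cardinality of the set $\mathrm{Oolp}_l$ of orthogonal oriented link patterns of size $l$. Then the sequence $(o_l)_{l\geq 0}$ is determined by $o_0=1$, $o_1=1$, and $o_l=o_{l-1}+4(l-1)o_{l-2}$ for $l\geq 2$.
   Context: An orthogonal oriented link pattern (oolp) of size $l$ consists of $l$ vertices $1,2,\dots,l$ together with a collection of oriented arrows between these vertices and a collection of oriented arrows with dots between these vertices, such that: (B) every vertex is touched by at most one arrow (dotted or not); (SpOr) there are no loops without dots (no undotted arrow from a vertex to itself); (Or) there are no loops with dots (no dotted arrow from a vertex to itself). $\mathrm{Oolp}_l$ denotes the set of oolps of size $l$. *)

theory Defs
  imports Main
begin

text \<open>
  An oriented arrow from \<open>i\<close> to \<open>j\<close> is the pair \<open>(i, j)\<close>, a loop being a pair \<open>(i, i)\<close>.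
  A pattern is a pair \<open>(A, D)\<close> of sets, the undotted arrows \<open>A\<close> and the dotted arrows \<open>D\<close>.
  The same pair may a priori belong to both sets; it then stands for two different arrows.
\<close>

type_synonym arrow = "nat \<times> nat"

definition touching :: "nat \<Rightarrow> arrow set \<Rightarrow> arrow set" where
  "touching v S = {a \<in> S. fst a = v \<or> snd a = v}"

text \<open>
  Both sets are subsets of the finite set \<open>{1..l} \<times> {1..l}\<close>, so the cardinalities
  below are genuine and their sum is the number of arrows, dotted or not, touching \<open>v\<close>.
\<close>

definition is_oolp :: "nat \<Rightarrow> arrow set \<times> arrow set \<Rightarrow> bool" where
  "is_oolp l = (\<lambda>(A, D).
     A \<subseteq> {1..l} \<times> {1..l} \<and> D \<subseteq> {1..l} \<times> {1..l} \<and>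
     (\<forall>v\<in>{1..l}. card (touching v A) + card (touching v D) \<le> 1) \<and>
     (\<forall>v\<in>{1..l}. (v, v) \<notin> A) \<and>
     (\<forall>v\<in>{1..l}. (v, v) \<notin> D))"

definition Oolp :: "nat \<Rightarrow> (arrow set \<times> arrow set) set" where
  "Oolp l = {p. is_oolp l p}"

definition oolp_count :: "nat \<Rightarrow> nat" where
  "oolp_count l = card (Oolp l)"

end

theory Submission
  imports Defs
begin

text \<open>
  Encode both kinds of arrows as a single set of triples \<open>(dotted, source, target)\<close>, over an
  arbitrary finite vertex set. Fix a vertex \<open>v\<close>, and let \<open>n\<close> be the number of other vertices.
  A pattern either leaves \<open>v\<close> untouched, or contains exactly one of the \<open>4n\<close> arrows between \<open>v\<close>
  and another vertex \<open>w\<close>; the remaining arrows then form a pattern on the vertices other than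
  \<open>v\<close> and \<open>w\<close>.
\<close>

definition ends :: "bool \<times> 'a \<times> 'a \<Rightarrow> 'a set" where
  "ends a = {fst (snd a), snd (snd a)}"

text \<open>Condition (B) is phrased by pairwise disjoint ends instead of by counting, which suits
  adding and deleting single arrows. Any vertex set is allowed, so that removing vertices requires
  no renumbering.\<close>

definition patterns :: "'a set \<Rightarrow> (bool \<times> 'a \<times> 'a) set set" where
  "patterns V = {S. (\<forall>a\<in>S. ends a \<subseteq> V \<and> fst (snd a) \<noteq> snd (snd a)) \<and>
     (\<forall>a\<in>S. \<forall>b\<in>S. ends a \<inter> ends b \<noteq> {} \<longrightarrow> a = b)}"

lemma finite_patterns:
  assumes "finite V"
  shows "finite (patterns V)"
proof (rule finite_subset)
  show "patterns V \<subseteq> Pow (UNIV \<times> V \<times> V)"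
    by (auto simp: patterns_def ends_def)
  show "finite (Pow ((UNIV :: bool set) \<times> V \<times> V))"
    using assms by simp
qed

lemma patterns_empty: "patterns {} = {{}}"
  by (auto simp: patterns_def ends_def)

lemma ends_subset_patterns: "S \<in> patterns V \<Longrightarrow> a \<in> S \<Longrightarrow> ends a \<subseteq> V"
  by (auto simp: patterns_def)

definition arrows_at :: "'a \<Rightarrow> 'a set \<Rightarrow> (bool \<times> 'a \<times> 'a) set" where
  "arrows_at v V = UNIV \<times> ({v} \<times> V \<union> V \<times> {v})"

text \<open>The factor 4 is two choices for the dot times two directions;
  \<open>v \<notin> V\<close> keeps the directions apart.\<close>

lemma card_arrows_at:
  assumes "finite V" "v \<notin> V"
  shows "card (arrows_at v V) = 4 * card V"
proof -
  have "card ({v} \<times> V \<union> V \<times> {v}) = card ({v} \<times> V) + card (V \<times> {v})"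
    using assms by (intro card_Un_disjoint) auto
  then show ?thesis
    by (simp add: arrows_at_def card_cartesian_product)
qed

lemma arrows_at_ends:
  assumes "a \<in> arrows_at v V"
  obtains w where "w \<in> V" "ends a = {v, w}"
  using assms by (auto simp: arrows_at_def ends_def insert_commute)

lemma patterns_insert:
  assumes "v \<notin> V"
  shows "patterns (insert v V) =
    patterns V \<union> (\<Union>a\<in>arrows_at v V. insert a ` patterns (V - ends a))"
    (is "?L = ?R")
proof (intro equalityI subsetI)
  fix S assume S: "S \<in> ?L"
  show "S \<in> ?R"
  proof (cases "\<exists>a\<in>S. v \<in> ends a")
    case False
    with S have "S \<in> patterns V"
      by (auto simp: patterns_def)
    then show ?thesis ..
  next
    case True
    then obtain a where a: "a \<in> S" "v \<in> ends a"
      by blast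
    \<comment> \<open>Loops are excluded, so the end of \<open>a\<close> other than \<open>v\<close>
      lies in \<open>V\<close>.\<close>
    have "a \<in> arrows_at v V"
      using S a by (cases a) (auto simp: patterns_def arrows_at_def ends_def)
    \<comment> \<open>All other arrows have ends disjoint from those of \<open>a\<close>, hence also
      avoid \<open>v\<close>.\<close>
    moreover have "S - {a} \<in> patterns (V - ends a)"
      using S a unfolding patterns_def by blast
    moreover have "S = insert a (S - {a})"
      using a by blast
    ultimately show ?thesis
      by blast
  qed
next
  fix S assume "S \<in> ?R"
  then consider "S \<in> patterns V"
    | a T where "a \<in> arrows_at v V" "T \<in> patterns (V - ends a)" "S = insert a T"
    by blast
  then show "S \<in> ?L"
  proof cases
    case 1
    then show ?thesis
      unfolding patterns_def by blast
  next
    case 2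
    have "ends a \<subseteq> insert v V" "fst (snd a) \<noteq> snd (snd a)"
      using 2(1) assms by (auto simp: arrows_at_def ends_def)
    moreover have "ends a \<inter> ends b = {}" if "b \<in> T" for b
      using ends_subset_patterns[OF 2(2) that] by blast
    ultimately show ?thesis
      using 2(2) unfolding 2(3) patterns_def by blast
  qed
qed

lemma card_patterns_insert:
  assumes "finite V" "v \<notin> V"
  shows "card (patterns (insert v V)) =
    card (patterns V) + (\<Sum>a\<in>arrows_at v V. card (patterns (V - ends a)))"
proof -
  let ?F = "\<lambda>a. insert a ` patterns (V - ends a)"
  have fin: "finite (arrows_at v V)"
    using assms by (simp add: arrows_at_def)
  have v: "v \<in> ends a" if "a \<in> arrows_at v V" for a
    using that by (auto simp: arrows_at_def ends_def)
  \<comment> \<open>This one fact yields injectivity of \<open>insert a\<close> and both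
    disjointness claims: the arrow at \<open>v\<close> can be read off from the pattern. The set
    \<open>B\<close> is \<open>ends a\<close>, \<open>ends b\<close> or empty in the different
    uses.\<close>
  have no_v: "a \<notin> T" if "a \<in> arrows_at v V" "T \<in> patterns (V - B)" for a T B
    using ends_subset_patterns[OF that(2)] v[OF that(1)] assms(2) by blast
  have "inj_on (insert a) (patterns (V - ends a))" if "a \<in> arrows_at v V" for a
    using no_v[OF that] by (intro inj_onI) (metis insert_ident)
  then have card_F: "card (?F a) = card (patterns (V - ends a))" if "a \<in> arrows_at v V" for a
    using that by (simp add: card_image)
  have "?F a \<inter> ?F b = {}" if "a \<in> arrows_at v V" "b \<in> arrows_at v V" "a \<noteq> b" for a b
    using no_v that by blast
  then have "card (\<Union>a\<in>arrows_at v V. ?F a) = (\<Sum>a\<in>arrows_at v V. card (patterns (V - ends a)))"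
    using fin assms(1) by (subst card_UN_disjoint) (auto simp: finite_patterns card_F)
  moreover have "patterns V \<inter> (\<Union>a\<in>arrows_at v V. ?F a) = {}"
    using no_v[where B = "{}"] by auto
  ultimately show ?thesis
    using fin assms
    by (simp add: patterns_insert card_Un_disjoint finite_patterns)
qed

fun pattern_number :: "nat \<Rightarrow> nat" where
  "pattern_number 0 = 1"
| "pattern_number (Suc 0) = 1"
| "pattern_number (Suc (Suc n)) = pattern_number (Suc n) + 4 * Suc n * pattern_number n"

text \<open>Induction over proper subsets covers both smaller vertex sets, \<open>W\<close> and
  \<open>W - {w}\<close>.\<close>

lemma card_patterns:
  assumes "finite V"
  shows "card (patterns V) = pattern_number (card V)"
  using assms
proof (induction V rule: finite_psubset_induct)
  case (psubset V)
  show ?case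
  proof (cases "V = {}")
    case True
    then show ?thesis
      by (simp add: patterns_empty)
  next
    case False
    then obtain v W where V: "V = insert v W" "v \<notin> W"
      by (metis ex_in_conv mk_disjoint_insert)
    have W: "finite W"
      using psubset.hyps V by simp
    have "card (patterns (W - ends a)) = pattern_number (card W - 1)"
      if a: "a \<in> arrows_at v W" for a
    proof -
      obtain w where w: "w \<in> W" "ends a = {v, w}"
        using arrows_at_ends[OF a] .
      then have "W - ends a = W - {w}"
        using V(2) by auto
      then show ?thesis
        using psubset.IH[of "W - {w}"] V w W by (auto simp: card_Diff_singleton)
    qed
    then have "card (patterns V) =
        pattern_number (card W) + 4 * card W * pattern_number (card W - 1)"
      using psubset.IH[of W] V W by (auto simp: card_patterns_insert card_arrows_at)
    also have "\<dots> = pattern_number (card V)"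
      \<comment> \<open>If \<open>card W = 0\<close>, the truncated \<open>card W - 1\<close> is
        harmless, since its term carries the factor 0.\<close>
      using V W by (cases "card W") auto
    finally show ?thesis .
  qed
qed

text \<open>The tag makes this a disjoint union: a pair lying in both sets still counts as two
  arrows.\<close>

definition label_arrows :: "arrow set \<times> arrow set \<Rightarrow> (bool \<times> nat \<times> nat) set" where
  "label_arrows = (\<lambda>(A, D). {False} \<times> A \<union> {True} \<times> D)"

lemma ball_label_arrows:
  "(\<forall>a\<in>label_arrows (A, D). P a) \<longleftrightarrow> (\<forall>a\<in>A. P (False, a)) \<and> (\<forall>a\<in>D. P (True, a))"
  by (auto simp: label_arrows_def)

text \<open>The sum is the cardinality of the set of labelled arrows at \<open>v\<close>, and a
  finite set has at most one element iff any two of its elements agree. Finiteness matters because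
  \<open>card\<close> is 0 on infinite sets.\<close>

lemma touching_disjoint_iff:
  assumes "finite A" "finite D"
  shows "card (touching v A) + card (touching v D) \<le> 1 \<longleftrightarrow>
    (\<forall>a\<in>label_arrows (A, D). \<forall>b\<in>label_arrows (A, D). v \<in> ends a \<inter> ends b \<longrightarrow> a = b)"
proof -
  let ?T = "{a \<in> label_arrows (A, D). v \<in> ends a}"
  have fin: "finite (touching v A)" "finite (touching v D)"
    using assms by (auto simp: touching_def)
  have T: "?T = {False} \<times> touching v A \<union> {True} \<times> touching v D"
    by (auto simp: label_arrows_def touching_def ends_def)
  have "card ?T = card (touching v A) + card (touching v D)"
    unfolding T using fin
    by (subst card_Un_disjoint) (auto simp: card_cartesian_product)
  moreover have "card ?T \<le> 1 \<longleftrightarrow> (\<forall>a\<in>?T. \<forall>b\<in>?T. a = b)"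
    unfolding One_nat_def by (rule card_le_Suc0_iff_eq) (use fin in \<open>simp add: T\<close>)
  ultimately have "card (touching v A) + card (touching v D) \<le> 1 \<longleftrightarrow>
      (\<forall>a\<in>?T. \<forall>b\<in>?T. a = b)"
    by (simp only:)
  then show ?thesis
    by blast
qed

lemma is_oolp_iff: "is_oolp l p \<longleftrightarrow> label_arrows p \<in> patterns {1..l}"
proof (cases p)
  case (Pair A D)
  let ?V = "{1..l}" and ?S = "label_arrows (A, D)"
  have range: "A \<subseteq> ?V \<times> ?V \<and> D \<subseteq> ?V \<times> ?V \<longleftrightarrow> (\<forall>a\<in>?S. ends a \<subseteq> ?V)"
    unfolding ball_label_arrows by (auto simp: ends_def)
  \<comment> \<open>The conditions on the left only quantify over vertices in \<open>{1..l}\<close>.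
    Hence this equivalence and the next one assume that all ends lie there; for the next one this
    also gives finiteness.\<close>
  have loops: "(\<forall>v\<in>?V. (v, v) \<notin> A) \<and> (\<forall>v\<in>?V. (v, v) \<notin> D) \<longleftrightarrow>
      (\<forall>a\<in>?S. fst (snd a) \<noteq> snd (snd a))" if "\<forall>a\<in>?S. ends a \<subseteq> ?V"
    using that unfolding ball_label_arrows by (auto simp: ends_def)
  have disjoint: "(\<forall>v\<in>?V. card (touching v A) + card (touching v D) \<le> 1) \<longleftrightarrow>
      (\<forall>a\<in>?S. \<forall>b\<in>?S. ends a \<inter> ends b \<noteq> {} \<longrightarrow> a = b)" if *: "\<forall>a\<in>?S. ends a \<subseteq> ?V"
  proof -
    have "finite A" "finite D"
      using * range by (meson finite_SigmaI finite_atLeastAtMost finite_subset)+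
    then show ?thesis
      using * unfolding touching_disjoint_iff[OF \<open>finite A\<close> \<open>finite D\<close>] by blast
  qed
  show ?thesis
    using range loops disjoint
    unfolding Pair is_oolp_def patterns_def prod.case mem_Collect_eq ball_conj_distrib by argo
qed

text \<open>Splitting a labelled set by its tag gives the inverse. Being a bijection of the whole
  types, the map preserves cardinality under preimages.\<close>

lemma bij_label_arrows: "bij label_arrows"
proof (rule bijI)
  show "inj label_arrows"
    by (rule injI) (auto simp: label_arrows_def set_eq_iff)
  have "S = label_arrows ({a. (False, a) \<in> S}, {a. (True, a) \<in> S})" for S
    by (auto simp: label_arrows_def) (metis (full_types))+
  then show "surj label_arrows"
    by (rule surjI[OF sym])
qed

lemma oolp_count_eq: "oolp_count l = pattern_number l"
proof -
  have "Oolp l = label_arrows -` patterns {1..l}"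
    by (auto simp: Oolp_def is_oolp_iff)
  then have "card (Oolp l) = card (patterns {1..l})"
    using bij_label_arrows by (simp add: card_vimage_inj bij_is_inj bij_is_surj)
  then show ?thesis
    by (simp add: oolp_count_def card_patterns)
qed

theorem proposition6p10:
  shows "oolp_count 0 = 1 \<and> oolp_count 1 = 1 \<and>
     (\<forall>l\<ge>2. oolp_count l = oolp_count (l - 1) + 4 * (l - 1) * oolp_count (l - 2)) \<and>
     (\<forall>f :: nat \<Rightarrow> nat.
        f 0 = 1 \<and> f 1 = 1 \<and> (\<forall>l\<ge>2. f l = f (l - 1) + 4 * (l - 1) * f (l - 2))
        \<longrightarrow> f = oolp_count)"
proof (intro conjI allI impI)
  show "oolp_count 0 = 1" "oolp_count 1 = 1"
    by (simp_all add: oolp_count_eq)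
  fix l :: nat assume "2 \<le> l"
  then obtain n where "l = Suc (Suc n)"
    by (metis add_2_eq_Suc le_Suc_ex)
  then show "oolp_count l = oolp_count (l - 1) + 4 * (l - 1) * oolp_count (l - 2)"
    by (simp add: oolp_count_eq)
next
  fix f :: "nat \<Rightarrow> nat"
  assume f: "f 0 = 1 \<and> f 1 = 1 \<and> (\<forall>l\<ge>2. f l = f (l - 1) + 4 * (l - 1) * f (l - 2))"
  \<comment> \<open>Uniqueness: \<open>f\<close> obeys the defining equations of
    \<open>pattern_number\<close>, with \<open>l = Suc (Suc n)\<close> in the recursive one, so
    induction along that recursion applies.\<close>
  have "f n = pattern_number n" for n
  proof (induction n rule: pattern_number.induct)
    case (3 n)
    then show ?case
      using f[THEN conjunct2, THEN conjunct2, rule_format, of "Suc (Suc n)"] by simp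
  qed (use f in simp_all)
  then show "f = oolp_count"
    by (simp add: fun_eq_iff oolp_count_eq)
qed

end
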